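(* Let $R>r>0$ be real numbers. The map $\pi_t\circ g_t:T\to C_T$ is the inverse of $\overline{t}:C_T\to T$, and it is continuous.
   Context: On the square $[-1,1]^2$ the equivalence relation $\sim_{CT}$ is: $(u,v)\sim_{CT}(u',v')$ if and only if [$u'=u$ or ($u\in\{-1,1\}$ and $u'=-u$)] and [$v'=v$ or ($v\in\{-1,1\}$ and $v'=-v$)]. $C_T=[-1,1]^2/\!\sim_{CT}$ carries the quotient topology and $\pi_t:[-1,1]^2\to C_T$ is the canonical surjection. For $R>r>0$, the map $t:[-1,1]^2\to\mathbb{R}^3$ is defined by $$t(u,v)=\Big(\big(R+r\cos(v\pi)\big)\cos(u\pi),\ \big(R+r\cos(v\pi)\big)\sin(u\pi),\ r\sin(v\pi)\Big),$$ and $T=t([-1,1]^2)\subset\mathbb{R}^3$ has the subspace topology. The map $t$ is compatible with $\sim_{CT}$, and $\overline{t}:C_T\to T$ is the unique continuous map with $t=\overline{t}\circ\pi_t$. For $(x,y)\neq(0,0)$, $\operatorname{atan2}(y,x)\in(-\pi,\pi]$ denotes the polar angle of the point $(x,y)$: $\operatorname{atan2}(0,x)=0$ if $x>0$ and $\pi$ if $x<0$; and for $y\ne0$, $\operatorname{atan2}(y,x)=\arctan(y/x)$ if $x>0$, $\varepsilon(y)\frac{\pi}{2}$ if $x=0$, $\arctan(y/x)+\varepsilon(y)\pi$ if $x<0$, where $\varepsilon(y)=\pm1$ is the sign of $y$. The map $g_t:T\to[-1,1]^2$ is defined by $g_t(x,y,z)=\big(\frac1\pi\operatorname{atan2}(y,x),\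 \beta(x,y,z)\big)$, where $\beta(x,y,z)=\frac1\pi\operatorname{atan2}(z,x-R)$ if $\operatorname{atan2}(y,x)=0$; $\beta(x,y,z)=\frac1\pi\operatorname{atan2}(z,-x-R)$ if $\operatorname{atan2}(y,x)=\pi$; and $\beta(x,y,z)=\frac1\pi\operatorname{atan2}\Big(z,\frac{y}{\sin(\operatorname{atan2}(y,x))}-R\Big)$ otherwise. *)

theory Defs
  imports "HOL-Analysis.Analysis"
begin

definition square :: "(real \<times> real) set" where
  "square = {-1..1} \<times> {-1..1}"

definition simCT :: "((real \<times> real) \<times> (real \<times> real)) set" where
  "simCT = {((u, v), (u', v')). (u, v) \<in> square \<and> (u', v') \<in> square \<and>
      (u' = u \<or> (u \<in> {-1, 1} \<and> u' = - u)) \<and>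
      (v' = v \<or> (v \<in> {-1, 1} \<and> v' = - v))}"

lemma equiv_simCT: "equiv square simCT"
  by (rule equivI) (auto simp: simCT_def square_def refl_on_def sym_def trans_def)

definition CT :: "(real \<times> real) set set" where
  "CT = square // simCT"

definition pi_t :: "real \<times> real \<Rightarrow> (real \<times> real) set" where
  "pi_t w = simCT `` {w}"

lemma pi_t_image: "pi_t ` square = CT"
  by (auto simp: pi_t_def CT_def quotient_def)

definition CT_topology :: "(real \<times> real) set topology" where
  "CT_topology =
     topology (\<lambda>U. U \<subseteq> CT \<and> openin (top_of_set square) {w \<in> square. pi_t w \<in> U})"

lemma openin_CT_topology:
  "openin CT_topology U \<longleftrightarrow> U \<subseteq> CT \<and> openin (top_of_set square) {w \<in> square. pi_t w \<in> U}"
proof -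
  have "istopology (\<lambda>U. U \<subseteq> CT \<and> openin (top_of_set square) {w \<in> square. pi_t w \<in> U})"
    unfolding istopology_def
  proof (intro conjI allI impI)
    fix S S' assume "S \<subseteq> CT \<and> openin (top_of_set square) {w \<in> square. pi_t w \<in> S}"
      and "S' \<subseteq> CT \<and> openin (top_of_set square) {w \<in> square. pi_t w \<in> S'}"
    moreover have "{w \<in> square. pi_t w \<in> S \<inter> S'} =
        {w \<in> square. pi_t w \<in> S} \<inter> {w \<in> square. pi_t w \<in> S'}"
      by auto
    ultimately show "S \<inter> S' \<subseteq> CT" "openin (top_of_set square) {w \<in> square. pi_t w \<in> S \<inter> S'}"
      by auto
  next
    fix K assume K: "\<forall>S\<in>K. S \<subseteq> CT \<and> openin (top_of_set square) {w \<in> square. pi_t w \<in> S}"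
    then show "\<Union>K \<subseteq> CT" by auto
    have "{w \<in> square. pi_t w \<in> \<Union>K} = (\<Union>S\<in>K. {w \<in> square. pi_t w \<in> S})" by auto
    then show "openin (top_of_set square) {w \<in> square. pi_t w \<in> \<Union>K}"
      using K by auto
  qed
  then show ?thesis
    by (simp add: CT_topology_def topology_inverse')
qed

lemma topspace_CT_topology [simp]: "topspace CT_topology = CT"
proof -
  have "{w \<in> square. pi_t w \<in> CT} = square"
    using pi_t_image by auto
  then have "openin CT_topology CT"
    by (simp add: openin_CT_topology)
  then show ?thesis
    using openin_subset openin_CT_topology openin_topspace by blast
qed

lemma quotient_map_pi_t: "quotient_map (top_of_set square) CT_topology pi_t"
  using pi_t_image by (simp add: quotient_map_def openin_CT_topology)

definition t :: "real \<Rightarrow> real \<Rightarrow> real \<times> real \<Rightarrow> real \<times> real \<times> real" where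
  "t R r = (\<lambda>(u, v). ((R + r * cos (v * pi)) * cos (u * pi),
                      (R + r * cos (v * pi)) * sin (u * pi),
                      r * sin (v * pi)))"

definition T :: "real \<Rightarrow> real \<Rightarrow> (real \<times> real \<times> real) set" where
  "T R r = t R r ` square"

(* HOL functions are total: the conjunct f \<in> extensional CT fixes the values outside CT
   and so makes the map unique as a HOL function. *)
definition t_bar :: "real \<Rightarrow> real \<Rightarrow> (real \<times> real) set \<Rightarrow> real \<times> real \<times> real" where
  "t_bar R r = (THE f. f \<in> extensional CT \<and>
      continuous_map CT_topology (top_of_set (T R r)) f \<and>
      (\<forall>w\<in>square. t R r w = f (pi_t w)))"

lemma t_compatible: "(w, w') \<in> simCT \<Longrightarrow> t R r w = t R r w'"
  by (auto simp: simCT_def t_def)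

lemma t_bar_ex1:
  "\<exists>!f. f \<in> extensional CT \<and> continuous_map CT_topology (top_of_set (T R r)) f \<and>
      (\<forall>w\<in>square. t R r w = f (pi_t w))"
proof -
  have cont: "continuous_map (top_of_set square) (top_of_set (T R r)) (t R r)"
  proof -
    have "continuous_on square (t R r)"
      unfolding t_def split_beta by (intro continuous_intros)
    then show ?thesis by (simp add: T_def)
  qed
  have comp: "t R r w = t R r w'"
    if "w \<in> topspace (top_of_set square)" "w' \<in> topspace (top_of_set square)" "pi_t w = pi_t w'"
    for w w'
  proof -
    have "(w, w') \<in> simCT"
      using that eq_equiv_class_iff[OF equiv_simCT] by (simp add: pi_t_def)
    then show ?thesis by (rule t_compatible)
  qed
  obtain g where g: "continuous_map CT_topology (top_of_set (T R r)) g"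
    and *: "\<And>w. w \<in> topspace (top_of_set square) \<Longrightarrow> g (pi_t w) = t R r w"
    by (rule quotient_map_lift_exists[OF quotient_map_pi_t cont comp]) (assumption+, rule that, assumption, blast)
  have g_pi: "g (pi_t w) = t R r w" if "w \<in> square" for w
    using that * by simp
  have pi_CT: "pi_t w \<in> CT" if "w \<in> square" for w
    using that pi_t_image by blast
  show ?thesis
  proof (rule ex1I[of _ "restrict g CT"], intro conjI ballI)
    show "restrict g CT \<in> extensional CT" by simp
    show "continuous_map CT_topology (top_of_set (T R r)) (restrict g CT)"
      by (rule continuous_map_eq[OF g]) simp
    show "t R r w = restrict g CT (pi_t w)" if "w \<in> square" for w
      using that g_pi pi_CT by simp
  next
    fix f assume f: "f \<in> extensional CT \<and> continuous_map CT_topology (top_of_set (T R r)) f \<and>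
      (\<forall>w\<in>square. t R r w = f (pi_t w))"
    show "f = restrict g CT"
    proof (rule extensionalityI[of _ CT])
      show "f \<in> extensional CT" using f by blast
      show "restrict g CT \<in> extensional CT" by simp
    next
      fix c assume c: "c \<in> CT"
      then obtain w where w: "w \<in> square" "c = pi_t w" using pi_t_image by blast
      then have "f c = t R r w" using f by simp
      then show "f c = restrict g CT c"
        using c w g_pi by simp
    qed
  qed
qed

(* The polar angle is not defined at the origin. *)
definition atan2 :: "real \<Rightarrow> real \<Rightarrow> real" where
  "atan2 y x =
     (if y = 0 then (if x > 0 then 0 else if x < 0 then pi else undefined)
      else if x > 0 then arctan (y / x)
      else if x = 0 then sgn y * (pi / 2)
      else arctan (y / x) + sgn y * pi)"

definition \<beta> :: "real \<Rightarrow> real \<times> real \<times> real \<Rightarrow> real" where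
  "\<beta> R = (\<lambda>(x, y, z).
     if atan2 y x = 0 then 1 / pi * atan2 z (x - R)
     else if atan2 y x = pi then 1 / pi * atan2 z (- x - R)
     else 1 / pi * atan2 z (y / sin (atan2 y x) - R))"

definition g_t :: "real \<Rightarrow> real \<times> real \<times> real \<Rightarrow> real \<times> real" where
  "g_t R = (\<lambda>(x, y, z). (1 / pi * atan2 y x, \<beta> R (x, y, z)))"

end

theory Submission
  imports Defs
begin

text \<open>
  Polar coordinates determine a point of the torus: from \<open>t (u, v)\<close> the polar angle of the
  horizontal projection gives \<open>u\<pi>\<close>, the distance \<open>R + r cos (v\<pi>)\<close> to the axis is then known,
  and with the height \<open>r sin (v\<pi>)\<close> it gives \<open>v\<pi>\<close> as a second polar angle. All this is exact on
  the half-open square, where both angles lie in \<open>(-\<pi>, \<pi>]\<close> (\<open>g_t_t\<close>). Every point of the closed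
  square is equivalent to one of the half-open square, and \<open>t\<close> and \<open>pi_t\<close> do not distinguish
  equivalent points; hence \<open>pi_t \<circ> g_t \<circ> t = pi_t\<close> on the whole square (\<open>pi_t_g_t_t\<close>), and this one
  identity contains both inverse laws.

  It contains continuity as well, although \<open>g_t\<close> itself jumps where an angle is \<open>\<pi>\<close>. The map \<open>t\<close>
  goes from a compact space onto a Hausdorff space, so it is closed and thus a quotient map
  (\<open>quotient_map_t\<close>). A map out of a quotient is continuous as soon as its composite with the
  quotient map is, and here the composite is the continuous map \<open>pi_t\<close>.
\<close>

lemma atan2_polar:
  assumes "\<rho> > 0" "- pi < \<theta>" "\<theta> \<le> pi"
  shows "atan2 (\<rho> * sin \<theta>) (\<rho> * cos \<theta>) = \<theta>"
proof -
  have quot: "\<rho> * sin \<theta> / (\<rho> * cos \<theta>) = tan \<theta>"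
    using assms(1) by (simp add: tan_def)
  consider "- (pi/2) < \<theta>" "\<theta> < pi/2" | "\<theta> = pi/2" | "\<theta> = - (pi/2)" | "\<theta> = pi"
    | "pi/2 < \<theta>" "\<theta> < pi" | "\<theta> < - (pi/2)"
    using assms by linarith
  then show ?thesis
  proof cases
    case 1
    then have c: "cos \<theta> > 0" by (intro cos_gt_zero_pi) auto
    show ?thesis
    proof (cases "\<theta> = 0")
      case True
      then show ?thesis using assms by (simp add: atan2_def)
    next
      case False
      then have "sin \<theta> \<noteq> 0"
        using sin_eq_0_pi[of \<theta>] 1 pi_gt_zero by linarith
      then show ?thesis
        using c assms 1 quot by (simp add: atan2_def arctan_tan)
    qed
  next
    case 2
    show ?thesis unfolding 2 using assms(1) by (simp add: atan2_def)
  next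
    case 3
    show ?thesis unfolding 3 using assms(1) by (simp add: atan2_def)
  next
    case 4
    then show ?thesis using assms by (simp add: atan2_def)
  next
    case 5
    have s: "sin \<theta> > 0" using 5 by (intro sin_gt_zero) (use pi_gt_zero in linarith)+
    have "cos (pi - \<theta>) > 0" using 5 by (intro cos_gt_zero_pi) linarith+
    then have c: "cos \<theta> < 0" by (simp add: cos_diff)
    have "arctan (tan \<theta>) = \<theta> - pi"
      using arctan_tan[of "\<theta> - pi"] 5 tan_periodic_pi[of "\<theta> - pi"] by simp
    then show ?thesis
      using s c assms(1) quot by (simp add: atan2_def mult_less_0_iff zero_less_mult_iff)
  next
    case 6
    have "sin (- \<theta>) > 0" using 6 assms by (intro sin_gt_zero) (use pi_gt_zero in linarith)+
    then have s: "sin \<theta> < 0" by simp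
    have "cos (pi + \<theta>) > 0" using 6 assms by (intro cos_gt_zero_pi) linarith+
    then have c: "cos \<theta> < 0" by (simp add: cos_add)
    have "arctan (tan \<theta>) = \<theta> + pi"
      using arctan_tan[of "\<theta> + pi"] 6 assms tan_periodic_pi[of \<theta>] by simp
    then show ?thesis
      using s c assms(1) quot by (simp add: atan2_def mult_less_0_iff zero_less_mult_iff)
  qed
qed

text \<open>
  As \<open>R > r\<close>, the distance \<open>A\<close> to the axis is positive, so \<open>atan2\<close> recovers \<open>u\<pi>\<close>. The three
  branches of \<open>\<beta>\<close> are three ways to read \<open>A\<close> off \<open>(x, y)\<close>: the quotient \<open>y / sin (u\<pi>)\<close> is \<open>A\<close>
  unless the sine vanishes, and in those two cases \<open>x\<close> is \<open>A\<close> or \<open>-A\<close>.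
\<close>
lemma g_t_t:
  assumes "R > r" "r > 0" "- 1 < u" "u \<le> 1" "- 1 < v" "v \<le> 1"
  shows "g_t R (t R r (u, v)) = (u, v)"
proof -
  have angle: "- pi < w * pi \<and> w * pi \<le> pi" if "- 1 < w" "w \<le> 1" for w :: real
    using that mult_strict_right_mono[of "- 1" w pi] mult_right_mono[of w 1 pi] by simp
  define A where "A = R + r * cos (v * pi)"
  have "r * (- 1) \<le> r * cos (v * pi)"
    using assms by (intro mult_left_mono) auto
  then have "A > 0" unfolding A_def using assms by simp
  then have au: "atan2 (A * sin (u * pi)) (A * cos (u * pi)) = u * pi"
    using angle assms by (intro atan2_polar) auto
  have av: "atan2 (r * sin (v * pi)) (A - R) = v * pi"
    unfolding A_def using atan2_polar[of r "v * pi"] angle assms by simp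
  have "\<beta> R (t R r (u, v)) = v"
  proof (cases "u = 0 \<or> u = 1")
    case True
    then show ?thesis
      using au av by (auto simp: \<beta>_def t_def A_def[symmetric])
  next
    case False
    then have "sin (u * pi) \<noteq> 0"
      using assms sin_zero_iff_int2[of "u * pi"] by auto
    then show ?thesis
      using False au av by (simp add: \<beta>_def t_def A_def[symmetric])
  qed
  then show ?thesis
    using au by (simp add: g_t_def t_def A_def[symmetric])
qed

lemma half_open_representative:
  assumes "w \<in> square"
  obtains u v where "(w, (u, v)) \<in> simCT" "- 1 < u" "u \<le> 1" "- 1 < v" "v \<le> 1"
proof -
  obtain a b where w: "w = (a, b)" by fastforce
  show ?thesis
    by (rule that[of "if a = - 1 then 1 else a" "if b = - 1 then 1 else b"])
      (use assms in \<open>auto simp: w simCT_def square_def\<close>)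
qed

lemma pi_t_g_t_t:
  assumes "R > r" "r > 0" "w \<in> square"
  shows "pi_t (g_t R (t R r w)) = pi_t w"
proof -
  obtain u v where uv: "(w, (u, v)) \<in> simCT" "- 1 < u" "u \<le> 1" "- 1 < v" "v \<le> 1"
    using half_open_representative[OF assms(3)] .
  have "pi_t w = pi_t (u, v)"
    unfolding pi_t_def by (rule equiv_class_eq[OF equiv_simCT uv(1)])
  then show ?thesis
    using g_t_t[OF assms(1,2) uv(2-)] t_compatible[OF uv(1)] by simp
qed

lemma quotient_map_t: "quotient_map (top_of_set square) (top_of_set (T R r)) (t R r)"
proof (rule continuous_closed_imp_quotient_map)
  have "continuous_on square (t R r)"
    unfolding t_def split_beta by (intro continuous_intros)
  then show cont: "continuous_map (top_of_set square) (top_of_set (T R r)) (t R r)"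
    by (simp add: T_def)
  have "compact square"
    unfolding square_def by (intro compact_Times compact_Icc)
  then show "closed_map (top_of_set square) (top_of_set (T R r)) (t R r)"
    by (intro continuous_imp_closed_map cont)
      (simp_all add: compact_space_subtopology Hausdorff_space_subtopology)
qed (simp add: T_def)

lemma t_bar_pi_t: "w \<in> square \<Longrightarrow> t_bar R r (pi_t w) = t R r w"
  using theI'[OF t_bar_ex1[of R r]] unfolding t_bar_def by simp

theorem mainTheorem6:
  fixes R r :: real
  assumes "R > r" and "r > 0"
  shows "t_bar R r \<in> CT \<rightarrow> T R r
    \<and> pi_t \<circ> g_t R \<in> T R r \<rightarrow> CT
    \<and> (\<forall>p\<in>T R r. t_bar R r ((pi_t \<circ> g_t R) p) = p)
    \<and> (\<forall>c\<in>CT. (pi_t \<circ> g_t R) (t_bar R r c) = c)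
    \<and> continuous_map (top_of_set (T R r)) CT_topology (pi_t \<circ> g_t R)"
proof (intro conjI)
  note key = pi_t_g_t_t[OF assms]
  show "t_bar R r \<in> CT \<rightarrow> T R r"
    by (auto simp: pi_t_image[symmetric] T_def t_bar_pi_t)
  show "pi_t \<circ> g_t R \<in> T R r \<rightarrow> CT"
    by (auto simp: pi_t_image[symmetric] T_def key)
  show "\<forall>p\<in>T R r. t_bar R r ((pi_t \<circ> g_t R) p) = p"
    by (auto simp: T_def key t_bar_pi_t)
  show "\<forall>c\<in>CT. (pi_t \<circ> g_t R) (t_bar R r c) = c"
    by (auto simp: pi_t_image[symmetric] key t_bar_pi_t)
  have "continuous_map (top_of_set square) CT_topology ((pi_t \<circ> g_t R) \<circ> t R r)"
    by (rule continuous_map_eq[OF quotient_imp_continuous_map[OF quotient_map_pi_t]])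
      (simp add: key)
  then show "continuous_map (top_of_set (T R r)) CT_topology (pi_t \<circ> g_t R)"
    by (rule continuous_compose_quotient_map[OF quotient_map_t])
qed

end
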